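(* Let $\Gamma$ be a locally finite graph, $S$ a nonempty finite set of vertices of $\Gamma$, $\Gamma'_S$ the split graph of $S$, $S'$ a subset of the vertex set of $\Gamma'_S$ with $S\subset S'$, and $h_0:S'\to(0,\infty)$ a function. Assume that $S'$ admits a cooling function rel $h_0$ (in the graph $\Gamma'_S$). (1) If $N$ is the minimum possible norm of a cooling function for $S'$ rel $h_0$, then the reciprocal $1/N$ is given by the minimum value of a convex function $A$ on the simplex $\Delta(S')$ as follows: $$\frac1N=\min_{f\in\Delta(S')}A(f),\qquad A(f)=\sum_{e\in E(S')}\bigl|\tilde f(i(e))-\tilde f(t(e))\bigr|.$$ (2) The minimum possible norm $N$ is given by the maximum Følner ratio: $$N=\max_{S_0\subset S'}FR(S_0).$$ (3) If $FR(S_0)$ realizes the maximum in (2), then the function $f\in\Delta(S')$ whose modification $\tilde f$ is constant on $S_0$ and $0$ on $S'\setminus S_0$ realizes the minimum in (1).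
   Context: For a finite set $S$ of vertices of a locally finite graph, $E(S)$ is the set of edges having at least one vertex in $S$ and $\partial E(S)\subset E(S)$ is the set of edges having exactly one vertex in $S$. Edges $e\in E(S)$ are oriented, with initial vertex $i(e)$ and terminal vertex $t(e)$; edges of $\partial E(S)$ are oriented so that $i(e)\in S$, $t(e)\notin S$; other orientations are arbitrary. Split graph: let $\Gamma_S=\bigcup\{e: e\in E(S)\}$ (the subgraph of $\Gamma$ consisting of the edges of $E(S)$ and their endpoints). The graph $\Gamma'_S$ is formed from $\Gamma_S$ by splitting all edges $e\in\partial E(S)$ apart at any common vertex in the complement of $S$, so that distinct boundary edges have distinct terminal vertices in the complement of $S$ (each vertex outside $S$ thus is the endpoint of exactly one edge). The edges of $\Gamma'_S$ correspond bijectively to $E(S)$ and keep their orientations. All of the following is computed in the graph $\Gamma'_S$. $E(S')$ is the set of edges of $\Gamma'_S$ with at least one vertex in $S'$; for $S_0\subset S'$, $\partial E(S_0)$ is the set of edges of $\Gamma'_S$ with exactly one vertex in $S_0$. A cooling function for $S'$ rel $h_0$ is $c:E(S')\to\mathbb R$ with $\sum_{i(e)=s}c(e)-\sum_{t(e)=s}c(e)\ge h_0(s)$ for all $s\in S'$; its norm is $\max_{e\in E(S')}|c(e)|$. For $S_0\subset S'$, $H(S_0)=\sum_{s\in S_0}h_0(s)$, $FR(S_0)=H(S_0)/|\partial E(S_0)|$ for $S_0\ne\emptyset$ (the denominator is nonzero because $S'$ admits a cooling function), and $FR(\emptyset)=0$. $\Delta(S')$ is the set of functions $f:S'\to[0,1]$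 with $\sum_{s\in S'}f(s)=1$. For $f\in\Delta(S')$ the modification $\tilde f$ is the function on the set of all endpoints of edges in $E(S')$ given by $\tilde f(v)=f(v)/h_0(v)$ for $v\in S'$ and $\tilde f(v)=0$ for $v\notin S'$. *)

theory Defs
  imports "HOL-Analysis.Analysis"
begin

text \<open>Undirected graphs; multiple edges and loops are allowed, a loop having a single endpoint.\<close>

record ('v, 'e) ugraph =
  verts :: "'v set"
  edges :: "'e set"
  ends :: "'e \<Rightarrow> 'v set"

definition wf_ugraph :: "('v, 'e, 'm) ugraph_scheme \<Rightarrow> bool" where
  "wf_ugraph G \<longleftrightarrow>
     (\<forall>e\<in>edges G. ends G e \<subseteq> verts G \<and> (card (ends G e) = 1 \<or> card (ends G e) = 2))"

definition locally_finite :: "('v, 'e, 'm) ugraph_scheme \<Rightarrow> bool" where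
  "locally_finite G \<longleftrightarrow> (\<forall>v\<in>verts G. finite {e \<in> edges G. v \<in> ends G e})"

definition edges_at :: "('v, 'e, 'm) ugraph_scheme \<Rightarrow> 'v set \<Rightarrow> 'e set" where
  "edges_at G S = {e \<in> edges G. ends G e \<inter> S \<noteq> {}}"

text \<open>The edges with exactly one vertex in \<open>S\<close>. The other vertex must lie outside \<open>S\<close>
  (it is to be the terminal vertex of the edge), so a loop is never a boundary edge.\<close>

definition boundary_edges :: "('v, 'e, 'm) ugraph_scheme \<Rightarrow> 'v set \<Rightarrow> 'e set" where
  "boundary_edges G S = {e \<in> edges G. ends G e \<inter> S \<noteq> {} \<and> ends G e - S \<noteq> {}}"

definition orientation_at ::
  "('v, 'e, 'm) ugraph_scheme \<Rightarrow> 'v set \<Rightarrow> ('e \<Rightarrow> 'v) \<Rightarrow> ('e \<Rightarrow> 'v) \<Rightarrow> bool" where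
  "orientation_at G S i t \<longleftrightarrow>
     (\<forall>e \<in> edges_at G S. ends G e = {i e, t e}) \<and>
     (\<forall>e \<in> boundary_edges G S. i e \<in> S \<and> t e \<notin> S)"

record ('v, 'e) oriented_graph = "('v, 'e) ugraph" +
  initial :: "'e \<Rightarrow> 'v"
  terminal :: "'e \<Rightarrow> 'v"

text \<open>In the split graph a vertex of \<open>S\<close> is kept as \<open>Orig s\<close>, and each boundary edge \<open>e\<close>
  gets a terminal vertex \<open>Split e\<close> of its own.\<close>

datatype ('v, 'e) split_vertex = Orig 'v | Split 'e

definition split_end :: "'v set \<Rightarrow> 'e \<Rightarrow> 'v \<Rightarrow> ('v, 'e) split_vertex" where
  "split_end S e v = (if v \<in> S then Orig v else Split e)"

definition split_graph ::
  "('v, 'e, 'm) ugraph_scheme \<Rightarrow> 'v set \<Rightarrow> ('e \<Rightarrow> 'v) \<Rightarrow> ('e \<Rightarrow> 'v)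
     \<Rightarrow> (('v, 'e) split_vertex, 'e) oriented_graph" where
  "split_graph G S i t =
     \<lparr>verts = (\<Union>e \<in> edges_at G S. split_end S e ` ends G e),
      edges = edges_at G S,
      ends = (\<lambda>e. split_end S e ` ends G e),
      initial = (\<lambda>e. split_end S e (i e)),
      terminal = (\<lambda>e. split_end S e (t e))\<rparr>"

definition cooling_function ::
  "('v, 'e) oriented_graph \<Rightarrow> 'v set \<Rightarrow> ('v \<Rightarrow> real) \<Rightarrow> ('e \<Rightarrow> real) \<Rightarrow> bool" where
  "cooling_function G S h c \<longleftrightarrow>
     (\<forall>s\<in>S. (\<Sum>e | e \<in> edges_at G S \<and> initial G e = s. c e)
            - (\<Sum>e | e \<in> edges_at G S \<and> terminal G e = s. c e) \<ge> h s)"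

definition cooling_norm :: "('v, 'e) oriented_graph \<Rightarrow> 'v set \<Rightarrow> ('e \<Rightarrow> real) \<Rightarrow> real" where
  "cooling_norm G S c = Max ((\<lambda>e. \<bar>c e\<bar>) ` edges_at G S)"

definition folner_ratio :: "('v, 'e) oriented_graph \<Rightarrow> ('v \<Rightarrow> real) \<Rightarrow> 'v set \<Rightarrow> real" where
  "folner_ratio G h S\<^sub>0 =
     (if S\<^sub>0 = {} then 0 else (\<Sum>s\<in>S\<^sub>0. h s) / real (card (boundary_edges G S\<^sub>0)))"

text \<open>Functions on \<open>S\<close> are represented by extensional functions, so that the simplex contains
  exactly one HOL function for each function on \<open>S\<close>.\<close>

definition simplex_on :: "'v set \<Rightarrow> ('v \<Rightarrow> real) set" where
  "simplex_on S = {f \<in> S \<rightarrow>\<^sub>E {0..1}. (\<Sum>s\<in>S. f s) = 1}"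

definition modification :: "'v set \<Rightarrow> ('v \<Rightarrow> real) \<Rightarrow> ('v \<Rightarrow> real) \<Rightarrow> 'v \<Rightarrow> real" where
  "modification S h f v = (if v \<in> S then f v / h v else 0)"

definition variation ::
  "('v, 'e) oriented_graph \<Rightarrow> 'v set \<Rightarrow> ('v \<Rightarrow> real) \<Rightarrow> ('v \<Rightarrow> real) \<Rightarrow> real" where
  "variation G S h f =
     (\<Sum>e\<in>edges_at G S. \<bar>modification S h f (initial G e) - modification S h f (terminal G e)\<bar>)"

text \<open>The library's \<^const>\<open>convex_on\<close> needs a real vector space type, which the function type is
  not; this is the same notion for extensional functions on \<open>S\<close>.\<close>

definition convex_on_functions ::
  "'v set \<Rightarrow> ('v \<Rightarrow> real) set \<Rightarrow> (('v \<Rightarrow> real) \<Rightarrow> real) \<Rightarrow> bool" where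
  "convex_on_functions S D F \<longleftrightarrow>
     (\<forall>f\<in>D. \<forall>g\<in>D. \<forall>u\<ge>0. \<forall>v\<ge>0. u + v = 1 \<longrightarrow>
        (\<lambda>x\<in>S. u * f x + v * g x) \<in> D \<and>
        F (\<lambda>x\<in>S. u * f x + v * g x) \<le> u * F f + v * F g)"

definition is_minimum :: "real set \<Rightarrow> real \<Rightarrow> bool" where
  "is_minimum X m \<longleftrightarrow> m \<in> X \<and> (\<forall>x\<in>X. m \<le> x)"

definition is_maximum :: "real set \<Rightarrow> real \<Rightarrow> bool" where
  "is_maximum X m \<longleftrightarrow> m \<in> X \<and> (\<forall>x\<in>X. x \<le> m)"

end

theory Submission
  imports Defs
begin

text \<open>With \<open>M\<close> the largest Folner ratio, a cooling function of norm at most \<open>M\<close> is found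
  among the functions bounded by \<open>M\<close> on the edges: take one that minimises the sum of the squares
  of the deficits \<open>max 0 (h s - net s)\<close>. If the set \<open>R\<close> of vertices of positive deficit were
  nonempty, changing the value at a single edge shows that every boundary edge of \<open>R\<close> carries
  the full amount \<open>M\<close> out of \<open>R\<close>, so the net outflow of \<open>R\<close>, which is less than \<open>H(R)\<close>, equals
  \<open>M \<cdot> |\<partial>E(R)|\<close>, against the choice of \<open>M\<close>. Conversely, summation by parts gives
  \<open>1 \<le> \<Sum>s. g s * net c s = \<Sum>e. c e * (g (i e) - g (t e)) \<le> N * A f\<close> for the modification \<open>g\<close> of any \<open>f\<close> in
  the simplex; with normalised indicator functions in place of \<open>f\<close> this is the lower bound on the norm
  by Folner ratios, and all inequalities are equalities for a set of largest ratio.\<close>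

section \<open>Finite networks, net outflow and summation by parts\<close>

locale network =
  fixes G :: "('v, 'e) oriented_graph" and V :: "'v set" and h :: "'v \<Rightarrow> real"
  assumes finite_V: "finite V" and V_nonempty: "V \<noteq> {}"
    and finite_E: "finite (edges_at G V)"
    and ends_eq: "e \<in> edges_at G V \<Longrightarrow> ends G e = {initial G e, terminal G e}"
    and h_pos: "s \<in> V \<Longrightarrow> 0 < h s"
begin

abbreviation E :: "'e set" where "E \<equiv> edges_at G V"

text \<open>Both sums of the cooling condition are merged into one over \<open>E\<close>; this form
  is linear in \<open>c\<close>, lets vertex and edge sums be exchanged, and gives loops weight
  0.\<close>

definition net :: "('e \<Rightarrow> real) \<Rightarrow> 'v \<Rightarrow> real" where
  "net c s = (\<Sum>e\<in>E. c e * (of_bool (initial G e = s) - of_bool (terminal G e = s)))"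

lemma cooling_function_iff_net: "cooling_function G V h c \<longleftrightarrow> (\<forall>s\<in>V. h s \<le> net c s)"
proof -
  have "(\<Sum>e | e \<in> E \<and> initial G e = s. c e) - (\<Sum>e | e \<in> E \<and> terminal G e = s. c e) = net c s" for s
    unfolding net_def sum.inter_filter[OF finite_E] right_diff_distrib sum_subtractf
    by (intro arg_cong2[where f = minus] sum.cong) auto
  then show ?thesis by (simp add: cooling_function_def)
qed

text \<open>An edge meeting \<open>A\<close> also meets \<open>V\<close>, so \<open>ends_eq\<close>
  applies to it.\<close>

lemma boundary_edges_eq:
  assumes "A \<subseteq> V"
  shows "boundary_edges G A = {e \<in> E. (initial G e \<in> A) \<noteq> (terminal G e \<in> A)}"
proof -
  have "boundary_edges G A \<subseteq> E" using assms by (auto simp: boundary_edges_def edges_at_def)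
  moreover have "e \<in> boundary_edges G A \<longleftrightarrow> (initial G e \<in> A) \<noteq> (terminal G e \<in> A)" if "e \<in> E" for e
    using ends_eq[OF that] that by (auto simp: boundary_edges_def edges_at_def)
  ultimately show ?thesis by blast
qed

text \<open>Exchanging the sums collects at each edge the values of \<open>g\<close> at its two
  ends. Ends outside \<open>V\<close> do not occur on the left, and there \<open>g\<close>
  vanishes.\<close>

lemma sum_by_parts:
  assumes "\<And>v. v \<notin> V \<Longrightarrow> g v = 0"
  shows "(\<Sum>s\<in>V. g s * net c s) = (\<Sum>e\<in>E. c e * (g (initial G e) - g (terminal G e)))"
proof -
  have *: "(\<Sum>s\<in>V. g s * of_bool (v = s)) = g v" for v
    using assms[of v] finite_V by (simp add: of_bool_def if_distrib sum.delta' cong: if_cong)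
  have "(\<Sum>s\<in>V. g s * net c s)
      = (\<Sum>e\<in>E. \<Sum>s\<in>V. c e * (g s * of_bool (initial G e = s) - g s * of_bool (terminal G e = s)))"
    unfolding net_def sum_distrib_left by (subst sum.swap) (simp add: algebra_simps)
  also have "\<dots> = (\<Sum>e\<in>E. c e * (g (initial G e) - g (terminal G e)))"
    by (simp add: sum_distrib_left[symmetric] sum_subtractf *)
  finally show ?thesis .
qed

lemma sum_boundary:
  assumes "A \<subseteq> V"
  shows "(\<Sum>e\<in>E. \<bar>of_bool (initial G e \<in> A) - of_bool (terminal G e \<in> A) :: real\<bar>)
    = real (card (boundary_edges G A))"
proof -
  have "(\<Sum>e\<in>E. \<bar>of_bool (initial G e \<in> A) - of_bool (terminal G e \<in> A) :: real\<bar>)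
      = (\<Sum>e\<in>E. of_bool ((initial G e \<in> A) \<noteq> (terminal G e \<in> A)))"
    by (rule sum.cong) auto
  also have "\<dots> = real (card (boundary_edges G A))"
    using finite_E by (simp add: boundary_edges_eq[OF assms] Int_def)
  finally show ?thesis .
qed

lemma sum_net:
  assumes "A \<subseteq> V"
  shows "(\<Sum>s\<in>A. net c s)
    = (\<Sum>e\<in>E. c e * (of_bool (initial G e \<in> A) - of_bool (terminal G e \<in> A)))"
proof -
  have "(\<Sum>s\<in>A. net c s) = (\<Sum>s\<in>V. of_bool (s \<in> A) * net c s)"
    using assms by (intro sum.mono_neutral_cong_left finite_V) auto
  also have "\<dots> = (\<Sum>e\<in>E. c e * (of_bool (initial G e \<in> A) - of_bool (terminal G e \<in> A)))"
    using assms by (intro sum_by_parts) auto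
  finally show ?thesis .
qed

section \<open>Lower bounds on the norm of a cooling function\<close>

lemma abs_le_cooling_norm: "e \<in> E \<Longrightarrow> \<bar>c e\<bar> \<le> cooling_norm G V c"
  unfolding cooling_norm_def using finite_E by (intro Max_ge) auto

text \<open>The Hoelder inequality between the maximum norm of \<open>c\<close> and the sum norm of
  \<open>x\<close>.\<close>

lemma sum_le_cooling_norm:
  "(\<Sum>e\<in>E. c e * x e) \<le> cooling_norm G V c * (\<Sum>e\<in>E. \<bar>x e\<bar>)"
  unfolding sum_distrib_left
proof (rule sum_mono)
  fix e assume "e \<in> E"
  have "c e * x e \<le> \<bar>c e\<bar> * \<bar>x e\<bar>" by (metis abs_ge_self abs_mult)
  also have "\<dots> \<le> cooling_norm G V c * \<bar>x e\<bar>"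
    using abs_le_cooling_norm[OF \<open>e \<in> E\<close>] by (intro mult_right_mono) auto
  finally show "c e * x e \<le> cooling_norm G V c * \<bar>x e\<bar>" .
qed

text \<open>In the net outflow of \<open>A\<close> the edges inside \<open>A\<close> cancel, and
  each boundary edge carries at most the norm.\<close>

lemma sum_h_le_boundary:
  assumes "cooling_function G V h c" "A \<subseteq> V"
  shows "(\<Sum>s\<in>A. h s) \<le> cooling_norm G V c * real (card (boundary_edges G A))"
proof -
  have "(\<Sum>s\<in>A. h s) \<le> (\<Sum>s\<in>A. net c s)"
    using assms by (intro sum_mono) (auto simp: cooling_function_iff_net)
  also have "\<dots> \<le> cooling_norm G V c * real (card (boundary_edges G A))"
    unfolding sum_net[OF assms(2)] sum_boundary[OF assms(2), symmetric] by (rule sum_le_cooling_norm)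
  finally show ?thesis .
qed

lemma sum_h_pos:
  assumes "A \<subseteq> V" "A \<noteq> {}"
  shows "0 < (\<Sum>s\<in>A. h s)"
  using assms finite_V h_pos by (intro sum_pos) (auto intro: finite_subset)

text \<open>A positive total demand cannot leave through an empty boundary; Folner ratios of
  nonempty sets are therefore genuine quotients.\<close>

lemma boundary_pos:
  assumes "cooling_function G V h c" "A \<subseteq> V" "A \<noteq> {}"
  shows "0 < real (card (boundary_edges G A))"
  using sum_h_le_boundary[OF assms(1,2)] sum_h_pos[OF assms(2,3)]
  by (cases "card (boundary_edges G A) = 0") auto

lemma folner_ratio_le_cooling_norm:
  assumes "cooling_function G V h c" "A \<subseteq> V" "A \<noteq> {}"
  shows "folner_ratio G h A \<le> cooling_norm G V c"
  using sum_h_le_boundary[OF assms(1,2)] boundary_pos[OF assms] assms(3)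
  by (simp add: folner_ratio_def pos_divide_le_eq)

section \<open>Existence of a cooling function from the cut condition\<close>

definition deficit :: "('e \<Rightarrow> real) \<Rightarrow> 'v \<Rightarrow> real" where
  "deficit c s = max 0 (h s - net c s)"

lemma continuous_deficit: "continuous_on X (\<lambda>c. deficit c s)"
  unfolding deficit_def net_def
  by (intro continuous_intros continuous_on_subset[OF continuous_on_product_coordinates]) auto

lemma exists_min_deficit:
  assumes "0 \<le> M"
  obtains c where "\<And>e. e \<in> E \<Longrightarrow> \<bar>c e\<bar> \<le> M"
    "\<And>c'. (\<And>e. e \<in> E \<Longrightarrow> \<bar>c' e\<bar> \<le> M)
       \<Longrightarrow> (\<Sum>s\<in>V. (deficit c s)\<^sup>2) \<le> (\<Sum>s\<in>V. (deficit c' s)\<^sup>2)"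
proof -
  \<comment> \<open>Values off \<open>E\<close> are pinned to 0: every factor is then compact, and
    so is the product, even over an infinite edge type.\<close>
  let ?K = "PiE UNIV (\<lambda>e. if e \<in> E then {-M..M} else {0})"
  let ?\<Phi> = "\<lambda>c. \<Sum>s\<in>V. (deficit c s)\<^sup>2"
  have "compactin (product_topology (\<lambda>e::'e. euclideanreal) UNIV) ?K"
    by (subst compactin_PiE) auto
  then have "compact ?K" by (simp add: euclidean_product_topology)
  moreover have "(\<lambda>e. 0) \<in> ?K" using assms by auto
  then have "?K \<noteq> {}" by blast
  moreover have "continuous_on ?K ?\<Phi>" by (intro continuous_intros continuous_deficit)
  ultimately obtain c where c: "c \<in> ?K" "\<forall>c'\<in>?K. ?\<Phi> c \<le> ?\<Phi> c'"
    by (meson continuous_attains_inf)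
  show ?thesis
  proof (rule that[of c])
    show "\<bar>c e\<bar> \<le> M" if "e \<in> E" for e
      using PiE_mem[OF c(1), of e] that by (simp add: abs_le_iff)
    show "?\<Phi> c \<le> ?\<Phi> c'" if c': "\<And>e. e \<in> E \<Longrightarrow> \<bar>c' e\<bar> \<le> M" for c'
    proof -
      \<comment> \<open>Truncation to \<open>E\<close> moves a competitor into the box without
        changing \<open>net\<close>.\<close>
      let ?c = "\<lambda>e. if e \<in> E then c' e else 0"
      have "?c \<in> ?K" using c' by (auto simp: abs_le_iff minus_le_iff)
      then have "?\<Phi> c \<le> ?\<Phi> ?c" using c(2) by (rule bspec[rotated])
      also have "net ?c = net c'" by (auto simp: net_def fun_eq_iff intro!: sum.cong)
      then have "?\<Phi> ?c = ?\<Phi> c'" by (simp add: deficit_def)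
      finally show ?thesis .
    qed
  qed
qed

lemma net_fun_upd:
  assumes "e \<in> E"
  shows "net (c(e := c e + x)) s
    = net c s + x * (of_bool (initial G e = s) - of_bool (terminal G e = s))"
  using finite_E assms by (simp add: net_def sum.remove[of _ e] algebra_simps)

text \<open>An amount \<open>x\<close> of net outflow moves from \<open>q\<close> to
  \<open>p\<close>: the deficit of \<open>p\<close> drops by \<open>x\<close>, that of
  \<open>q\<close> rises from 0 to at most \<open>x\<close>. If \<open>q\<close> lies outside
  \<open>V\<close>, its loss is not counted.\<close>

lemma deficit_sum_decreases:
  assumes "p \<in> V" "p \<noteq> q" "0 < deficit c p" "q \<in> V \<Longrightarrow> deficit c q = 0"
    and x: "0 < x" "2 * x \<le> deficit c p"
    and net': "net c' p = net c p + x" "net c' q = net c q - x"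
      "\<And>s. s \<noteq> p \<Longrightarrow> s \<noteq> q \<Longrightarrow> net c' s = net c s"
  shows "(\<Sum>s\<in>V. (deficit c' s)\<^sup>2) < (\<Sum>s\<in>V. (deficit c s)\<^sup>2)"
proof -
  let ?a = "deficit c p"
  have p: "deficit c' p = ?a - x" using assms by (simp add: deficit_def)
  \<comment> \<open>The two sides differ by \<open>2 * x * (?a - x)\<close>, which is positive since
    \<open>x\<close> is at most half of \<open>?a\<close>.\<close>
  have sq: "(?a - x)\<^sup>2 + x\<^sup>2 < ?a\<^sup>2"
  proof -
    have "2 * x * x \<le> ?a * x" using x by (intro mult_right_mono) auto
    moreover have "0 < ?a * x" using x assms(3) by simp
    ultimately show ?thesis by (simp add: power2_eq_square algebra_simps)
  qed
  have *: "(\<Sum>s\<in>V - {p}. (deficit c' s)\<^sup>2) \<le> (\<Sum>s\<in>V - {p}. (deficit c s)\<^sup>2) + x\<^sup>2"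
  proof -
    have "(deficit c' s)\<^sup>2 \<le> (deficit c s)\<^sup>2 + (if s = q then x\<^sup>2 else 0)" if "s \<in> V - {p}" for s
    proof (cases "s = q")
      case True
      then have "deficit c' q \<le> x" "0 \<le> deficit c' q"
        using assms(4) that net'(2) x(1) by (auto simp: deficit_def)
      then show ?thesis using True by (simp add: power_mono add_increasing)
    qed (use that net' in \<open>simp add: deficit_def\<close>)
    then have "(\<Sum>s\<in>V - {p}. (deficit c' s)\<^sup>2)
        \<le> (\<Sum>s\<in>V - {p}. (deficit c s)\<^sup>2 + (if s = q then x\<^sup>2 else 0))"
      by (rule sum_mono)
    also have "\<dots> \<le> (\<Sum>s\<in>V - {p}. (deficit c s)\<^sup>2) + x\<^sup>2"
      using finite_V by (simp add: sum.distrib)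
    finally show ?thesis .
  qed
  show ?thesis
    using * sq p by (simp add: sum.remove[OF finite_V \<open>p \<in> V\<close>])
qed

text \<open>The max-flow min-cut direction: \<open>cut\<close> says that no set demands more than
  its boundary can carry at capacity \<open>M\<close>.\<close>

lemma exists_cooling_function_bounded:
  assumes M: "0 \<le> M"
    and cut: "\<And>A. A \<subseteq> V \<Longrightarrow> (\<Sum>s\<in>A. h s) \<le> M * real (card (boundary_edges G A))"
  obtains c where "cooling_function G V h c" "\<And>e. e \<in> E \<Longrightarrow> \<bar>c e\<bar> \<le> M"
proof -
  obtain c where bound: "\<And>e. e \<in> E \<Longrightarrow> \<bar>c e\<bar> \<le> M"
    and min: "\<And>c'. (\<And>e. e \<in> E \<Longrightarrow> \<bar>c' e\<bar> \<le> M)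
       \<Longrightarrow> (\<Sum>s\<in>V. (deficit c s)\<^sup>2) \<le> (\<Sum>s\<in>V. (deficit c' s)\<^sup>2)"
    using exists_min_deficit[OF M] by blast
  define R where "R = {s \<in> V. 0 < deficit c s}"
  have RV: "R \<subseteq> V" by (auto simp: R_def)
  have dR: "deficit c q = 0" if "q \<in> V" "q \<notin> R" for q
    using that by (auto simp: R_def deficit_def)
  have out: "c e = M" if e: "e \<in> E" "initial G e \<in> R" "terminal G e \<notin> R" for e
  proof (rule ccontr)
    assume "c e \<noteq> M"
    then have less: "c e < M" using bound[OF e(1)] by auto
    \<comment> \<open>The first bound keeps the new value within capacity; the second makes the
      squared deficits strictly decrease.\<close>
    define x where "x = min (M - c e) (deficit c (initial G e) / 2)"
    let ?c = "c(e := c e + x)"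
    have x: "0 < x" "2 * x \<le> deficit c (initial G e)" "c e + x \<le> M"
      using less e by (auto simp: x_def R_def min_def field_simps)
    have ne: "initial G e \<noteq> terminal G e" using e by metis
    have "(\<Sum>s\<in>V. (deficit ?c s)\<^sup>2) < (\<Sum>s\<in>V. (deficit c s)\<^sup>2)"
      by (rule deficit_sum_decreases[of "initial G e" "terminal G e", OF _ ne _ _ x(1,2)])
        (use e ne dR in \<open>auto simp: net_fun_upd R_def\<close>)
    moreover have "\<bar>?c e'\<bar> \<le> M" if "e' \<in> E" for e'
      using bound[OF that] x by auto
    ultimately show False using min[of ?c] by fastforce
  qed
  \<comment> \<open>Mirror case: lowering the value on an edge entering \<open>R\<close> raises the
    net outflow of its terminal vertex.\<close>
  have into: "c e = - M" if e: "e \<in> E" "initial G e \<notin> R" "terminal G e \<in> R" for e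
  proof (rule ccontr)
    assume "c e \<noteq> - M"
    then have less: "- M < c e" using bound[OF e(1)] by auto
    define x where "x = min (M + c e) (deficit c (terminal G e) / 2)"
    let ?c = "c(e := c e + - x)"
    have x: "0 < x" "2 * x \<le> deficit c (terminal G e)" "- M \<le> c e - x"
      using less e by (auto simp: x_def R_def min_def field_simps)
    have ne: "terminal G e \<noteq> initial G e" using e by metis
    have "(\<Sum>s\<in>V. (deficit ?c s)\<^sup>2) < (\<Sum>s\<in>V. (deficit c s)\<^sup>2)"
      by (rule deficit_sum_decreases[of "terminal G e" "initial G e", OF _ ne _ _ x(1,2)])
        (use e ne dR in \<open>auto simp: net_fun_upd[OF e(1)] R_def simp del: add_uminus_conv_diff\<close>)
    moreover have "\<bar>?c e'\<bar> \<le> M" if "e' \<in> E" for e'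
      using bound[OF that] x by auto
    ultimately show False using min[of ?c] by fastforce
  qed
  have "R = {}"
  proof (rule ccontr)
    assume "R \<noteq> {}"
    \<comment> \<open>Edges with both or neither end in \<open>R\<close> have coefficient 0; every
      other edge contributes exactly \<open>M\<close> by \<open>out\<close> and
      \<open>into\<close>.\<close>
    have "(\<Sum>s\<in>R. net c s)
        = (\<Sum>e\<in>E. M * \<bar>of_bool (initial G e \<in> R) - of_bool (terminal G e \<in> R)\<bar>)"
      unfolding sum_net[OF RV] by (rule sum.cong) (auto simp: out into)
    also have "\<dots> = M * real (card (boundary_edges G R))"
      by (simp only: sum_distrib_left[symmetric] sum_boundary[OF RV])
    finally have "(\<Sum>s\<in>R. h s) \<le> (\<Sum>s\<in>R. net c s)" using cut[OF RV] by simp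
    moreover have "(\<Sum>s\<in>R. net c s) < (\<Sum>s\<in>R. h s)"
      using \<open>R \<noteq> {}\<close> finite_subset[OF RV finite_V]
      by (intro sum_strict_mono) (auto simp: R_def deficit_def)
    ultimately show False by simp
  qed
  then have "h s \<le> net c s" if "s \<in> V" for s
    using dR[OF that] by (auto simp: deficit_def max_def split: if_splits)
  then have "cooling_function G V h c" by (simp add: cooling_function_iff_net)
  then show ?thesis using that bound by blast
qed

section \<open>Convexity of the variation and weak duality\<close>

lemma convex_variation: "convex_on_functions V (simplex_on V) (variation G V h)"
  unfolding convex_on_functions_def
proof (intro ballI allI impI conjI)
  fix f g and u v :: real
  assume f: "f \<in> simplex_on V" and g: "g \<in> simplex_on V"
    and uv: "0 \<le> u" "0 \<le> v" "u + v = 1"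
  let ?k = "\<lambda>x\<in>V. u * f x + v * g x"
  have "u * f x + v * g x \<le> 1" if "x \<in> V" for x
    using f g uv that by (intro convex_bound_le) (auto simp: simplex_on_def)
  moreover have "(\<Sum>x\<in>V. u * f x + v * g x) = 1"
    using f g uv by (simp add: simplex_on_def sum.distrib sum_distrib_left[symmetric])
  ultimately show "?k \<in> simplex_on V"
    using f g uv by (auto simp: simplex_on_def PiE_def Pi_def)
  \<comment> \<open>The modification is linear in its function, so convexity reduces to the triangle
    inequality on each edge.\<close>
  have "modification V h ?k w = u * modification V h f w + v * modification V h g w" for w
    by (simp add: modification_def add_divide_distrib)
  then have "modification V h ?k a - modification V h ?k b
      = u * (modification V h f a - modification V h f b)
        + v * (modification V h g a - modification V h g b)" for a b
    by (simp add: algebra_simps)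
  then have "\<bar>modification V h ?k a - modification V h ?k b\<bar>
      \<le> u * \<bar>modification V h f a - modification V h f b\<bar>
        + v * \<bar>modification V h g a - modification V h g b\<bar>" for a b
    using abs_triangle_ineq[of "u * (modification V h f a - modification V h f b)"
        "v * (modification V h g a - modification V h g b)"] uv
    by (simp add: abs_mult)
  then show "variation G V h ?k \<le> u * variation G V h f + v * variation G V h g"
    unfolding variation_def sum_distrib_left sum.distrib[symmetric] by (intro sum_mono)
qed

lemma sum_modification:
  assumes "f \<in> simplex_on V"
  shows "(\<Sum>s\<in>V. modification V h f s * h s) = 1"
proof -
  have "(\<Sum>s\<in>V. modification V h f s * h s) = (\<Sum>s\<in>V. f s)"
    by (rule sum.cong) (auto simp: modification_def dest: h_pos)
  then show ?thesis using assms by (simp add: simplex_on_def)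
qed

text \<open>Weak duality: the cooling inequalities are weighted by the nonnegative modification of
  \<open>f\<close> and added, the total weighted demand being 1.\<close>

lemma one_le_norm_times_variation:
  assumes c: "cooling_function G V h c" and f: "f \<in> simplex_on V"
  shows "1 \<le> cooling_norm G V c * variation G V h f"
proof -
  let ?g = "modification V h f"
  have "0 \<le> ?g s" if "s \<in> V" for s
    using f h_pos[OF that] that by (auto simp: simplex_on_def modification_def PiE_def Pi_def)
  then have "(\<Sum>s\<in>V. ?g s * h s) \<le> (\<Sum>s\<in>V. ?g s * net c s)"
    using c by (intro sum_mono mult_left_mono) (auto simp: cooling_function_iff_net)
  also have "\<dots> = (\<Sum>e\<in>E. c e * (?g (initial G e) - ?g (terminal G e)))"
    by (rule sum_by_parts) (simp add: modification_def)
  also have "\<dots> \<le> cooling_norm G V c * variation G V h f"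
    unfolding variation_def by (rule sum_le_cooling_norm)
  finally show ?thesis using sum_modification[OF f] by simp
qed

section \<open>Vertex sets as points of the simplex\<close>

definition normalised_indicator :: "'v set \<Rightarrow> 'v \<Rightarrow> real" where
  "normalised_indicator A = (\<lambda>s\<in>V. if s \<in> A then h s / sum h A else 0)"

lemma normalised_indicator_in_simplex:
  assumes "A \<subseteq> V" "A \<noteq> {}"
  shows "normalised_indicator A \<in> simplex_on V"
proof -
  have fin: "finite A" using assms finite_V finite_subset by blast
  have pos: "0 < sum h A" using sum_h_pos[OF assms] .
  have "h s \<le> sum h A" if "s \<in> A" for s
    using that fin assms h_pos by (intro member_le_sum) (auto intro: less_imp_le)
  then have "h s / sum h A \<in> {0..1}" if "s \<in> A" for s
    using that pos assms h_pos[of s] by auto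
  moreover have "(\<Sum>s\<in>V. if s \<in> A then h s / sum h A else 0) = 1"
    using pos finite_V assms(1)
    by (simp add: sum.If_cases Int_absorb1 sum_divide_distrib[symmetric])
  ultimately show ?thesis by (auto simp: simplex_on_def normalised_indicator_def)
qed

text \<open>The factor \<open>h s\<close> of the indicator cancels against the division in the
  modification.\<close>

lemma modification_normalised_indicator:
  assumes "A \<subseteq> V"
  shows "modification V h (normalised_indicator A) s = of_bool (s \<in> A) / sum h A"
  using assms h_pos[of s] by (auto simp: modification_def normalised_indicator_def)

text \<open>On \<open>V\<close> such an \<open>f\<close> is \<open>k * h\<close> on \<open>A\<close>
  and 0 elsewhere, so total mass 1 determines \<open>k\<close>.\<close>

lemma normalised_indicator_unique:
  assumes A: "A \<subseteq> V" and f: "f \<in> simplex_on V"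
    and k: "\<forall>s\<in>A. modification V h f s = k" and z: "\<forall>s\<in>V - A. modification V h f s = 0"
  shows "f = normalised_indicator A"
proof -
  have fs: "f s = (if s \<in> A then k * h s else 0)" if "s \<in> V" for s
    using that k z h_pos[OF that] by (auto simp: modification_def field_simps)
  have "(\<Sum>s\<in>V. f s) = k * sum h A"
    using finite_V A by (simp add: fs sum.If_cases Int_absorb1 sum_distrib_left cong: sum.cong)
  then have "k * sum h A = 1" using f by (simp add: simplex_on_def)
  then have "k = 1 / sum h A" by (metis mult_zero_right nonzero_eq_divide_eq zero_neq_one)
  then show ?thesis
    using fs f by (auto simp: fun_eq_iff normalised_indicator_def simplex_on_def PiE_def extensional_def)
qed

text \<open>The modification jumps exactly on the boundary edges, each time by
  \<open>1 / sum h A\<close>. If the boundary is empty, both sides are 0 because division by 0 gives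
  0.\<close>

lemma variation_normalised_indicator:
  assumes "A \<subseteq> V" "A \<noteq> {}"
  shows "variation G V h (normalised_indicator A) = 1 / folner_ratio G h A"
proof -
  have "variation G V h (normalised_indicator A)
      = (\<Sum>e\<in>E. \<bar>of_bool (initial G e \<in> A) - of_bool (terminal G e \<in> A)\<bar> / sum h A)"
    using sum_h_pos[OF assms]
    by (simp add: variation_def modification_normalised_indicator[OF assms(1)]
        diff_divide_distrib[symmetric])
  then show ?thesis
    by (simp only: sum_divide_distrib[symmetric] sum_boundary[OF assms(1)])
      (simp add: folner_ratio_def assms)
qed

section \<open>Equality of the three extrema\<close>

theorem cooling_duality:
  assumes "\<exists>c. cooling_function G V h c"
  shows "\<exists>N. is_minimum {cooling_norm G V c | c. cooling_function G V h c} N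
    \<and> is_minimum (variation G V h ` simplex_on V) (1 / N)
    \<and> is_maximum (folner_ratio G h ` Pow V) N
    \<and> (\<forall>A\<subseteq>V. is_maximum (folner_ratio G h ` Pow V) (folner_ratio G h A) \<longrightarrow>
         A \<noteq> {} \<and> folner_ratio G h A = N)"
proof -
  obtain c0 where c0: "cooling_function G V h c0" using assms by blast
  define N where "N = Max (folner_ratio G h ` Pow V)"
  have le: "folner_ratio G h A \<le> N" if "A \<subseteq> V" for A
    unfolding N_def using finite_V that by (intro Max_ge) auto
  have "N \<in> folner_ratio G h ` Pow V"
    unfolding N_def using finite_V by (intro Max_in) auto
  then have max: "is_maximum (folner_ratio G h ` Pow V) N"
    using le by (auto simp: is_maximum_def)
  \<comment> \<open>The set \<open>V\<close> itself has positive ratio. Hence the empty set, of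
    ratio 0 by convention, is no maximiser, and \<open>N\<close> may be divided by.\<close>
  have pos: "0 < N"
  proof -
    have "0 < folner_ratio G h V"
      using sum_h_pos[of V] boundary_pos[OF c0, of V] V_nonempty by (simp add: folner_ratio_def)
    then show ?thesis using le[of V] by simp
  qed
  have max_iff: "A \<noteq> {} \<and> folner_ratio G h A = N"
    if "is_maximum (folner_ratio G h ` Pow V) (folner_ratio G h A)" for A
  proof -
    have "folner_ratio G h A = N" using that max by (auto simp: is_maximum_def intro: antisym)
    then show ?thesis using pos by (auto simp: folner_ratio_def)
  qed
  obtain A where A: "A \<subseteq> V" "A \<noteq> {}" "folner_ratio G h A = N"
    using \<open>N \<in> folner_ratio G h ` Pow V\<close> max max_iff by auto
  \<comment> \<open>Clearing denominators turns the maximality of \<open>N\<close> into the cut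
    condition.\<close>
  have "(\<Sum>s\<in>B. h s) \<le> N * real (card (boundary_edges G B))" if "B \<subseteq> V" for B
    using le[OF that] boundary_pos[OF c0 that]
    by (cases "B = {}") (auto simp: folner_ratio_def pos_divide_le_eq)
  then obtain c where c: "cooling_function G V h c" and bound: "\<And>e. e \<in> E \<Longrightarrow> \<bar>c e\<bar> \<le> N"
    using exists_cooling_function_bounded[of N] pos by auto
  have ge: "N \<le> cooling_norm G V c'" if "cooling_function G V h c'" for c'
    using folner_ratio_le_cooling_norm[OF that A(1,2)] A(3) by simp
  \<comment> \<open>\<open>Max\<close> is unspecified on the empty set, so an edge is needed before
    the norm can be bounded.\<close>
  have "E \<noteq> {}"
    using boundary_pos[OF c0 A(1,2)] by (auto simp: boundary_edges_eq[OF A(1)])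
  then have "cooling_norm G V c \<le> N"
    unfolding cooling_norm_def using finite_E bound by (intro Max.boundedI) auto
  then have norm_c: "cooling_norm G V c = N" using ge[OF c] by simp
  have "is_minimum {cooling_norm G V c | c. cooling_function G V h c} N"
    using norm_c c ge by (auto simp: is_minimum_def)
  moreover have "is_minimum (variation G V h ` simplex_on V) (1 / N)"
    unfolding is_minimum_def
  proof
    \<comment> \<open>The normalised indicator of the maximising set \<open>A\<close> attains the
      bound of weak duality for \<open>c\<close>.\<close>
    show "1 / N \<in> variation G V h ` simplex_on V"
      using normalised_indicator_in_simplex[OF A(1,2)] variation_normalised_indicator[OF A(1,2)] A(3)
      by (metis imageI)
    show "\<forall>x\<in>variation G V h ` simplex_on V. 1 / N \<le> x"
      using one_le_norm_times_variation[OF c] pos norm_c by (auto simp: pos_divide_le_eq mult.commute)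
  qed
  ultimately show ?thesis using max max_iff by blast
qed

end

section \<open>Application to the split graph\<close>

lemma network_split_graph:
  assumes "locally_finite \<Gamma>" "S \<subseteq> verts \<Gamma>" "finite S" "S \<noteq> {}" "orientation_at \<Gamma> S i t"
    and V: "V \<subseteq> verts (split_graph \<Gamma> S i t)" "Orig ` S \<subseteq> V"
    and "\<And>s. s \<in> V \<Longrightarrow> 0 < h s"
  shows "network (split_graph \<Gamma> S i t) V h"
proof
  let ?G = "split_graph \<Gamma> S i t"
  \<comment> \<open>Local finiteness and a finite \<open>S\<close> leave finitely many edges, and
    every vertex of the split graph is an end of one of them.\<close>
  have "edges_at \<Gamma> S = (\<Union>v\<in>S. {e \<in> edges \<Gamma>. v \<in> ends \<Gamma> e})" by (auto simp: edges_at_def)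
  then have fin: "finite (edges_at \<Gamma> S)"
    using assms(1-3) by (auto simp: locally_finite_def)
  have ends: "ends ?G e = {initial ?G e, terminal ?G e}" if "e \<in> edges_at \<Gamma> S" for e
    using that assms(5) by (simp add: orientation_at_def split_graph_def)
  have sub: "edges_at ?G V \<subseteq> edges_at \<Gamma> S" by (auto simp: edges_at_def split_graph_def)
  show "finite (edges_at ?G V)" using fin sub finite_subset by blast
  show "ends ?G e = {initial ?G e, terminal ?G e}" if "e \<in> edges_at ?G V" for e
    using ends sub that by blast
  have "verts ?G = (\<Union>e\<in>edges_at \<Gamma> S. ends ?G e)" by (simp add: split_graph_def)
  then have "finite (verts ?G)" using fin ends by simp
  then show "finite V" using V(1) finite_subset by blast
  show "V \<noteq> {}" using assms(4) V(2) by auto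
qed (use assms in auto)

theorem theorem5p1:
  fixes \<Gamma> :: "('v, 'e) ugraph"
    and S :: "'v set"
    and i t :: "'e \<Rightarrow> 'v"
    and \<Gamma>' :: "(('v, 'e) split_vertex, 'e) oriented_graph"
    and S' :: "('v, 'e) split_vertex set"
    and h\<^sub>0 :: "('v, 'e) split_vertex \<Rightarrow> real"
  assumes "wf_ugraph \<Gamma>" and "locally_finite \<Gamma>"
    and "S \<subseteq> verts \<Gamma>" and "finite S" and "S \<noteq> {}"
    and "orientation_at \<Gamma> S i t"
    and "\<Gamma>' = split_graph \<Gamma> S i t"
    and "S' \<subseteq> verts \<Gamma>'" and "Orig ` S \<subseteq> S'"
    and "\<And>s. s \<in> S' \<Longrightarrow> 0 < h\<^sub>0 s"
    and "\<exists>c. cooling_function \<Gamma>' S' h\<^sub>0 c"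
  shows "\<exists>N. is_minimum {cooling_norm \<Gamma>' S' c | c. cooling_function \<Gamma>' S' h\<^sub>0 c} N
    \<and> convex_on_functions S' (simplex_on S') (variation \<Gamma>' S' h\<^sub>0)
    \<and> is_minimum (variation \<Gamma>' S' h\<^sub>0 ` simplex_on S') (1 / N)
    \<and> is_maximum (folner_ratio \<Gamma>' h\<^sub>0 ` Pow S') N
    \<and> (\<forall>S\<^sub>0\<subseteq>S'. is_maximum (folner_ratio \<Gamma>' h\<^sub>0 ` Pow S') (folner_ratio \<Gamma>' h\<^sub>0 S\<^sub>0) \<longrightarrow>
         (\<exists>!f. f \<in> simplex_on S'
            \<and> (\<exists>k. \<forall>s\<in>S\<^sub>0. modification S' h\<^sub>0 f s = k)
            \<and> (\<forall>s\<in>S' - S\<^sub>0. modification S' h\<^sub>0 f s = 0))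
       \<and> (\<forall>f. f \<in> simplex_on S'
            \<and> (\<exists>k. \<forall>s\<in>S\<^sub>0. modification S' h\<^sub>0 f s = k)
            \<and> (\<forall>s\<in>S' - S\<^sub>0. modification S' h\<^sub>0 f s = 0)
            \<longrightarrow> is_minimum (variation \<Gamma>' S' h\<^sub>0 ` simplex_on S') (variation \<Gamma>' S' h\<^sub>0 f)))"
proof -
  interpret network \<Gamma>' S' h\<^sub>0
    using network_split_graph[OF assms(2-6)] assms(7-10) by blast
  obtain N where N: "is_minimum {cooling_norm \<Gamma>' S' c | c. cooling_function \<Gamma>' S' h\<^sub>0 c} N"
    and A_min: "is_minimum (variation \<Gamma>' S' h\<^sub>0 ` simplex_on S') (1 / N)"
    and FR_max: "is_maximum (folner_ratio \<Gamma>' h\<^sub>0 ` Pow S') N"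
    and FR_N: "\<And>A. A \<subseteq> S' \<Longrightarrow> is_maximum (folner_ratio \<Gamma>' h\<^sub>0 ` Pow S') (folner_ratio \<Gamma>' h\<^sub>0 A)
       \<Longrightarrow> A \<noteq> {} \<and> folner_ratio \<Gamma>' h\<^sub>0 A = N"
    using cooling_duality[OF assms(11)] by blast
  show ?thesis
  proof (intro exI[of _ N] conjI N A_min FR_max convex_variation allI impI)
    fix S\<^sub>0 assume S0: "S\<^sub>0 \<subseteq> S'"
      and "is_maximum (folner_ratio \<Gamma>' h\<^sub>0 ` Pow S') (folner_ratio \<Gamma>' h\<^sub>0 S\<^sub>0)"
    then have ne: "S\<^sub>0 \<noteq> {}" and FR: "folner_ratio \<Gamma>' h\<^sub>0 S\<^sub>0 = N" using FR_N by blast+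
    \<comment> \<open>These conditions single out one point of the simplex, so both remaining claims
      concern the normalised indicator of \<open>S\<^sub>0\<close>.\<close>
    let ?P = "\<lambda>f. f \<in> simplex_on S' \<and> (\<exists>k. \<forall>s\<in>S\<^sub>0. modification S' h\<^sub>0 f s = k)
            \<and> (\<forall>s\<in>S' - S\<^sub>0. modification S' h\<^sub>0 f s = 0)"
    have unique: "f = normalised_indicator S\<^sub>0" if "?P f" for f
      using that normalised_indicator_unique[OF S0] by blast
    have "?P (normalised_indicator S\<^sub>0)"
      using normalised_indicator_in_simplex[OF S0 ne]
      by (auto simp: modification_normalised_indicator[OF S0])
    then show "\<exists>!f. ?P f" by (rule ex1I[of ?P]) (rule unique)
    show "is_minimum (variation \<Gamma>' S' h\<^sub>0 ` simplex_on S') (variation \<Gamma>' S' h\<^sub>0 f)"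
      if "?P f" for f
      using unique[OF that] variation_normalised_indicator[OF S0 ne] FR A_min by simp
  qed
qed

end
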